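(* Let $P_n$ be the path on $n$ vertices. For all integers $k\geq 3$ and $n\geq 2k-1$, the inequality $p_k(P_n)\geq \left\lfloor \frac{3k}{2}\right\rfloor-2$ holds.
   Context: All graphs are finite simple graphs. $d_G(v,w)$ denotes the distance in $G$ between vertices $v$ and $w$. For a positive integer $p$, the $p$-th power $G^p$ of a graph $G$ is the simple graph with the same vertex set as $G$ in which two distinct vertices $v,w$ are adjacent if and only if $d_G(v,w)\leq p$. A graph $G$ is $k$-ordered Hamiltonian if for any sequence $v_1,v_2,\dots,v_k$ of $k$ distinct vertices of $G$ there is a Hamiltonian cycle in $G$ containing these vertices in the given order, i.e. traversing the cycle from $v_1$ in one of its two directions, one meets $v_1,v_2,\dots,v_k$ in this order before returning to $v_1$. For $k\geq 3$ and a graph $G$, $p_k(G)$ denotes the smallest integer $p$ such that $G^p$ is $k$-ordered Hamiltonian. *)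

theory Defs
  imports "Graph_Theory.Graph_Theory" "HOL-Library.Sublist"
begin

text \<open>
  A finite simple graph is a \<^locale>\<open>pair_graph\<close>: every edge \<open>vw\<close> is represented by the two
  arcs \<open>(v, w)\<close> and \<open>(w, v)\<close>.
\<close>

text \<open>The distance is the least length of a walk, and \<open>\<infinity>\<close> if there is none.\<close>

definition graph_dist :: "'a pair_pre_digraph \<Rightarrow> 'a \<Rightarrow> 'a \<Rightarrow> ereal" where
  "graph_dist G v w = wf_digraph.\<mu> (with_proj G) (\<lambda>_. 1) v w"

definition graph_power :: "'a pair_pre_digraph \<Rightarrow> nat \<Rightarrow> 'a pair_pre_digraph" where
  "graph_power G p = \<lparr> pverts = pverts G,
     parcs = {(v, w). v \<in> pverts G \<and> w \<in> pverts G \<and> v \<noteq> w \<and> graph_dist G v w \<le> ereal (real p)} \<rparr>"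

text \<open>
  A cycle is given by its list of arcs, which fixes a starting vertex and one of the two
  directions of traversal. The library's notion of cycle admits the closed walk \<open>v, w, v\<close> along
  a single edge, hence the lower bound on the length.
\<close>

definition hamiltonian_cycle :: "'a pair_pre_digraph \<Rightarrow> ('a \<times> 'a) awalk \<Rightarrow> bool" where
  "hamiltonian_cycle G c \<longleftrightarrow>
     pre_digraph.cycle (with_proj G) c \<and> 3 \<le> length c \<and> fst ` set c = pverts G"

text \<open>
  As \<open>c\<close> ranges over all arc lists of Hamiltonian cycles, both directions of traversal are
  covered; \<open>map fst c\<close> lists the vertices in the order in which they are met, each one once.
\<close>

definition ordered_hamiltonian :: "nat \<Rightarrow> 'a pair_pre_digraph \<Rightarrow> bool" where
  "ordered_hamiltonian k G \<longleftrightarrow>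
     (\<forall>vs. length vs = k \<and> distinct vs \<and> set vs \<subseteq> pverts G \<longrightarrow>
        (\<exists>c. hamiltonian_cycle G c \<and> fst (hd c) = hd vs \<and> subseq vs (map fst c)))"

definition ordered_power :: "nat \<Rightarrow> 'a pair_pre_digraph \<Rightarrow> nat" where
  "ordered_power k G = (LEAST p. 1 \<le> p \<and> ordered_hamiltonian k (graph_power G p))"

definition path_graph :: "nat \<Rightarrow> nat pair_pre_digraph" where
  "path_graph n = \<lparr> pverts = {..<n},
     parcs = {(i, j). i < n \<and> j < n \<and> (j = Suc i \<or> i = Suc j)} \<rparr>"

lemma pair_graph_path_graph: "pair_graph (path_graph n)"
proof -
  have "parcs (path_graph n) \<subseteq> {..<n} \<times> {..<n}"
    by (auto simp: path_graph_def)
  then have "finite (parcs (path_graph n))"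
    by (rule finite_subset) auto
  then show ?thesis
    by unfold_locales
      (auto simp: path_graph_def symmetric_def arcs_ends_def arc_to_ends_def sym_def)
qed

lemma graph_dist_commute:
  assumes "pair_graph G"
  shows "graph_dist G v w = graph_dist G w v"
proof -
  interpret pair_graph G by fact
  have cost: "awalk_cost (\<lambda>_. 1) c = real (length c)" for c :: "('a \<times> 'a) awalk"
    by (induction c) auto
  have le: "\<mu> (\<lambda>_. 1) v w \<le> \<mu> (\<lambda>_. 1) w v" for v w
    unfolding \<mu>_def
  proof (rule INF_mono)
    fix c assume "c \<in> {c. awalk w c v}"
    then have "awalk v (rev_path c) w"
      by simp
    moreover have "length (rev_path c) = length c"
      by (induction c) auto
    ultimately show "\<exists>d\<in>{c. awalk v c w}. ereal (awalk_cost (\<lambda>_. 1) d) \<le> ereal (awalk_cost (\<lambda>_. 1) c)"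
      by (intro bexI[of _ "rev_path c"]) (auto simp: cost)
  qed
  show ?thesis
    unfolding graph_dist_def using le[of v w] le[of w v] by simp
qed

lemma pair_graph_graph_power:
  assumes "pair_graph G"
  shows "pair_graph (graph_power G p)"
proof -
  interpret pair_graph G by fact
  have "parcs (graph_power G p) \<subseteq> pverts G \<times> pverts G"
    by (auto simp: graph_power_def)
  then have "finite (parcs (graph_power G p))"
    by (rule finite_subset) auto
  then show ?thesis
    using graph_dist_commute[OF assms]
    by unfold_locales
      (auto simp: graph_power_def symmetric_def arcs_ends_def arc_to_ends_def sym_def)
qed

end

theory Submission
  imports Defs
begin

text \<open>
  Put \<open>a = \<lceil>k/2\<rceil>\<close>, \<open>h = \<lfloor>k/2\<rfloor>\<close> and \<open>r = a + 2h - 1\<close>, so that the claimed bound is \<open>r - 1\<close>, and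
  prescribe the order \<open>0, r, 1, r + 1, 2, r + 2, \<dots>\<close>: left vertices \<open>0, \<dots>, a - 1\<close> alternate with
  right vertices \<open>r, \<dots>, r + h - 1\<close>, and only \<open>2h - 1\<close> vertices lie in between. Suppose all steps of
  the Hamiltonian cycle have length at most \<open>r - 2\<close>. Consecutive prescribed vertices have distance
  at least \<open>r - 1\<close>, so each of the first \<open>2h\<close> arcs of the cycle between them has an inner vertex
  next to its left end. That vertex is within \<open>r - 2\<close> of the left end, hence lies
  strictly between the two blocks. This gives \<open>2h\<close> distinct vertices among \<open>2h - 1\<close>.
\<close>

section \<open>Hamiltonian cycles as cyclic vertex lists\<close>

lemma pcas_iff: "pcas u c v \<longleftrightarrow> u # map snd c = map fst c @ [v]"
  by (induction c arbitrary: u) auto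

lemma pawalk_verts_eq: "pcas u c v \<Longrightarrow> pawalk_verts u c = u # map snd c"
  by (induction c arbitrary: u) auto

text \<open>Arcs chain up and close exactly when their heads are their tails rotated by one. The
  distinctness of heads demanded by the library's \<open>cycle\<close> then passes to the tails, so
  that a cycle can be handled through the list \<open>map fst c\<close>.\<close>

lemma hamiltonian_cycle_iff:
  "hamiltonian_cycle G c \<longleftrightarrow> 3 \<le> length c \<and> set c \<subseteq> parcs G \<and>
     map snd c = rotate1 (map fst c) \<and> distinct (map fst c) \<and> fst ` set c = pverts G"
proof -
  have closed: "(\<exists>u. u \<in> pverts G \<and> set c \<subseteq> parcs G \<and> pcas u c u \<and> distinct (tl (pawalk_verts u c)))
      \<longleftrightarrow> set c \<subseteq> parcs G \<and> map snd c = rotate1 (map fst c) \<and> distinct (map fst c)"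
    if "c \<noteq> []" "fst ` set c = pverts G"
  proof -
    obtain e es where c: "c = e # es"
      using \<open>c \<noteq> []\<close> by (cases c) auto
    \<comment> \<open>A closed walk must start at the tail of its first arc, which removes the
      existential over \<open>u\<close>.\<close>
    have cas: "pcas u c u \<longleftrightarrow> u = fst e \<and> map snd c = rotate1 (map fst c)" for u
      unfolding pcas_iff by (auto simp: c)
    have "fst e \<in> pverts G"
      using that c by auto
    moreover have "distinct (tl (pawalk_verts u c)) \<longleftrightarrow> distinct (map fst c)" if "pcas u c u" for u
      using iffD1[OF cas that] pawalk_verts_eq[OF that] by simp
    ultimately show ?thesis
      using cas by blast
  qed
  show ?thesis
  proof (cases "c \<noteq> [] \<and> fst ` set c = pverts G")
    case True
    then show ?thesis
      unfolding hamiltonian_cycle_def pre_digraph.cycle_def pre_digraph.awalk_def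
        with_proj_simps cas_with_proj_eq awalk_verts_with_proj_eq
      using closed by (simp add: conj_assoc) blast
  next
    case False
    then show ?thesis
      by (auto simp: hamiltonian_cycle_def)
  qed
qed

lemma hamiltonian_cycle_arc:
  assumes "hamiltonian_cycle G c" "Suc i < length c"
  shows "(map fst c ! i, map fst c ! Suc i) \<in> parcs G"
proof -
  have "map snd c ! i = rotate1 (map fst c) ! i"
    using assms(1) by (simp add: hamiltonian_cycle_iff)
  then have "snd (c ! i) = map fst c ! Suc i"
    using assms(2) by (simp add: nth_rotate1)
  moreover have "c ! i \<in> parcs G"
    using assms by (auto simp: hamiltonian_cycle_iff)
  ultimately show ?thesis
    using assms(2) by (metis Suc_lessD nth_map prod.collapse)
qed

lemma hamiltonian_cycle_last_arc:
  assumes "hamiltonian_cycle G c"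
  shows "(map fst c ! (length c - 1), map fst c ! 0) \<in> parcs G"
proof -
  have len: "3 \<le> length c"
    using assms by (simp add: hamiltonian_cycle_iff)
  have "map snd c ! (length c - 1) = rotate1 (map fst c) ! (length c - 1)"
    using assms by (simp add: hamiltonian_cycle_iff)
  moreover have "Suc (length c - 1) mod length c = 0"
    using len by (subst Suc_diff_1) auto
  ultimately have "snd (c ! (length c - 1)) = map fst c ! 0"
    using len by (simp add: nth_rotate1)
  moreover have "c ! (length c - 1) \<in> parcs G"
    using assms len by (auto simp: hamiltonian_cycle_iff)
  moreover have "map fst c ! (length c - 1) = fst (c ! (length c - 1))"
    using len by (intro nth_map) auto
  ultimately show ?thesis
    by (metis prod.collapse)
qed

text \<open>List the prescribed vertices first and the others after them in any order; completeness
  makes this cyclic list a Hamiltonian cycle. This shows that the \<open>LEAST\<close> in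
  \<open>ordered_power\<close> is attained.\<close>

lemma ordered_hamiltonian_complete:
  assumes "finite (pverts G)" "3 \<le> card (pverts G)"
    and complete: "\<And>v w. v \<in> pverts G \<Longrightarrow> w \<in> pverts G \<Longrightarrow> v \<noteq> w \<Longrightarrow> (v, w) \<in> parcs G"
    and "0 < k"
  shows "ordered_hamiltonian k G"
  unfolding ordered_hamiltonian_def
proof (intro allI impI)
  fix vs assume vs: "length vs = k \<and> distinct vs \<and> set vs \<subseteq> pverts G"
  obtain ws where ws: "set ws = pverts G - set vs" "distinct ws"
    using finite_distinct_list[of "pverts G - set vs"] assms(1) by auto
  define xs where "xs = vs @ ws"
  have xs: "set xs = pverts G" "distinct xs"
    using vs ws by (auto simp: xs_def)
  have len: "3 \<le> length xs"
    using assms(2) xs distinct_card[of xs] by simp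
  define c where "c = zip xs (rotate1 xs)"
  have fst_c: "map fst c = xs" and snd_c: "map snd c = rotate1 xs"
    by (simp_all add: c_def)
  have "set c \<subseteq> parcs G"
  proof
    fix e assume "e \<in> set c"
    then obtain i where i: "i < length xs" "e = (xs ! i, rotate1 xs ! i)"
      by (auto simp: c_def set_zip)
    then have e: "e = (xs ! i, xs ! (Suc i mod length xs))"
      by (simp add: nth_rotate1)
    have "Suc i mod length xs < length xs" "Suc i mod length xs \<noteq> i"
      using i(1) len by (auto simp: mod_Suc)
    then have "xs ! i \<noteq> xs ! (Suc i mod length xs)"
      using i(1) xs(2) by (simp add: nth_eq_iff_index_eq)
    moreover have "xs ! i \<in> pverts G" "xs ! (Suc i mod length xs) \<in> pverts G"
      using i(1) \<open>Suc i mod length xs < length xs\<close> xs(1) nth_mem by blast+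
    ultimately show "e \<in> parcs G"
      unfolding e by (intro complete)
  qed
  moreover have "fst ` set c = pverts G"
    using arg_cong[OF fst_c, of set] xs(1) by simp
  moreover have "length c = length xs"
    by (simp add: c_def)
  ultimately have "hamiltonian_cycle G c"
    unfolding hamiltonian_cycle_iff fst_c snd_c using len xs by simp
  moreover have "fst (hd c) = hd vs"
  proof -
    have "c \<noteq> []" "vs \<noteq> []"
      using \<open>length c = length xs\<close> len vs \<open>0 < k\<close> by auto
    then have "fst (hd c) = hd xs"
      by (metis fst_c hd_map)
    then show ?thesis
      using \<open>vs \<noteq> []\<close> by (simp add: xs_def)
  qed
  moreover have "subseq vs (map fst c)"
    unfolding fst_c xs_def by (rule list_emb_prefix) simp
  ultimately show "\<exists>c. hamiltonian_cycle G c \<and> fst (hd c) = hd vs \<and> subseq vs (map fst c)"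
    by blast
qed

section \<open>Distances in the path and adjacency in its powers\<close>

lemma path_walk_length:
  assumes "pcas v c w" "set c \<subseteq> parcs (path_graph n)"
  shows "nat \<bar>int v - int w\<bar> \<le> length c"
  using assms
proof (induction c arbitrary: v)
  case (Cons e c)
  then have "nat \<bar>int (snd e) - int w\<bar> \<le> length c" "fst e = v"
    by auto
  moreover have "snd e = Suc (fst e) \<or> fst e = Suc (snd e)"
    using Cons.prems by (auto simp: path_graph_def)
  ultimately show ?case
    by auto
qed auto

lemma path_walk_upwards:
  assumes "v + d < n"
  shows "\<exists>c. pcas v c (v + d) \<and> set c \<subseteq> parcs (path_graph n) \<and> length c = d"
  using assms
proof (induction d arbitrary: v)
  case (Suc d)
  then obtain c where "pcas (Suc v) c (Suc v + d)" "set c \<subseteq> parcs (path_graph n)" "length c = d"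
    using Suc.IH[of "Suc v"] by auto
  then show ?case
    using Suc.prems by (intro exI[of _ "(v, Suc v) # c"]) (auto simp: path_graph_def)
qed auto

text \<open>Each arc changes the vertex by one, which bounds every walk from below; the monotone
  walk attains the bound, and symmetry covers the case \<open>w < v\<close>.\<close>

lemma graph_dist_path_graph:
  assumes "v < n" "w < n"
  shows "graph_dist (path_graph n) v w = ereal (real (nat \<bar>int v - int w\<bar>))"
proof -
  interpret pair_graph "path_graph n"
    by (rule pair_graph_path_graph)
  have awalk_cost_length: "awalk_cost (\<lambda>_. 1) c = real (length c)" for c :: "(nat \<times> nat) awalk"
    by (induction c) auto
  have upper: "graph_dist (path_graph n) v w \<le> ereal (real (w - v))" if "v \<le> w" "w < n" for v w
  proof -
    obtain c where "pcas v c w" "set c \<subseteq> parcs (path_graph n)" "length c = w - v"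
      using path_walk_upwards[of v "w - v" n] \<open>v \<le> w\<close> \<open>w < n\<close> by auto
    moreover have "v \<in> pverts (path_graph n)"
      using that by (simp add: path_graph_def)
    ultimately have "awalk v c w"
      by (simp add: awalk_def)
    then have "\<mu> (\<lambda>_. 1) v w \<le> ereal (awalk_cost (\<lambda>_. 1) c)"
      by (rule min_cost_le_walk_cost)
    then show ?thesis
      by (simp add: graph_dist_def awalk_cost_length \<open>length c = w - v\<close>)
  qed
  have "graph_dist (path_graph n) v w \<le> ereal (real (nat \<bar>int v - int w\<bar>))"
  proof (cases "v \<le> w")
    case True
    then show ?thesis
      using upper[of v w] assms by (simp add: nat_diff_distrib')
  next
    case False
    then show ?thesis
      using upper[of w v] assms graph_dist_commute[OF pair_graph_path_graph, of n v w]
      by (simp add: nat_diff_distrib')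
  qed
  moreover have "ereal (real (nat \<bar>int v - int w\<bar>)) \<le> graph_dist (path_graph n) v w"
    unfolding graph_dist_def \<mu>_def
  proof (rule INF_greatest)
    fix c assume "c \<in> {c. awalk v c w}"
    then have "nat \<bar>int v - int w\<bar> \<le> length c"
      by (intro path_walk_length) (auto simp: awalk_def)
    then show "ereal (real (nat \<bar>int v - int w\<bar>)) \<le> ereal (awalk_cost (\<lambda>_. 1) c)"
      unfolding awalk_cost_length ereal_less_eq of_nat_le_iff .
  qed
  ultimately show ?thesis
    by (rule antisym)
qed

lemma parcs_power_path_graph:
  "(v, w) \<in> parcs (graph_power (path_graph n) p) \<longleftrightarrow>
     v < n \<and> w < n \<and> v \<noteq> w \<and> v \<le> w + p \<and> w \<le> v + p"
  using graph_dist_path_graph[of v n w]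
  by (auto simp: graph_power_def path_graph_def)

lemma pverts_power_path_graph: "pverts (graph_power (path_graph n) p) = {..<n}"
  by (simp add: graph_power_def path_graph_def)

section \<open>The lower bound for a fixed power\<close>

lemma subseq_indices:
  assumes "subseq xs ys"
  shows "\<exists>f. strict_mono_on {..<length xs} f \<and> (\<forall>i<length xs. f i < length ys \<and> ys ! f i = xs ! i)"
  using assms
proof (induction rule: list_emb.induct)
  case (list_emb_Nil ys)
  then show ?case
    by (auto simp: strict_mono_on_def)
next
  case (list_emb_Cons xs ys y)
  then obtain f where f: "strict_mono_on {..<length xs} f"
      "\<forall>i<length xs. f i < length ys \<and> ys ! f i = xs ! i"
    by auto
  then show ?case
    by (intro exI[of _ "\<lambda>i. Suc (f i)"]) (auto simp: strict_mono_on_def)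
next
  case (list_emb_Cons2 x y xs ys)
  then obtain f where f: "strict_mono_on {..<length xs} f"
      "\<forall>i<length xs. f i < length ys \<and> ys ! f i = xs ! i"
    by auto
  \<comment> \<open>The matched head takes position 0 and shifts all other positions by one.\<close>
  show ?case
    by (intro exI[of _ "\<lambda>i. case i of 0 \<Rightarrow> 0 | Suc j \<Rightarrow> Suc (f j)"])
      (use f \<open>x = y\<close> in \<open>auto simp: strict_mono_on_def split: nat.splits\<close>)
qed

lemma ordered_hamiltonian_path_power_lower_bound:
  assumes "3 \<le> k" "2 * k - 1 \<le> n"
    and ham: "ordered_hamiltonian k (graph_power (path_graph n) p)"
  shows "3 * k div 2 \<le> p + 2"
proof (rule ccontr)
  assume "\<not> 3 * k div 2 \<le> p + 2"
  define h where "h = k div 2"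
  define r where "r = k - h + 2 * h - 1"
  have k: "k = 2 * h \<or> k = Suc (2 * h)" and h: "1 \<le> h"
    using \<open>3 \<le> k\<close> by (auto simp: h_def)
  \<comment> \<open>In both parities \<open>3 * k div 2 = r + 1\<close>.\<close>
  have p: "p + 2 \<le> r"
    using \<open>\<not> _\<close> k by (auto simp: r_def)
  define v where "v t = (if even t then t div 2 else r + t div 2)" for t :: nat
  have v_even: "v (2 * i) = i" and v_odd: "v (Suc (2 * i)) = r + i" for i
    by (simp_all add: v_def)
  have left: "\<exists>t<k. v t = x" if "x < k - h" for x
    using that k by (intro exI[of _ "2 * x"]) (auto simp: v_even)
  have right: "\<exists>t<k. v t = x" if "r \<le> x" "x < r + h" for x
    using that k by (intro exI[of _ "Suc (2 * (x - r))"]) (auto simp: v_odd)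
  \<comment> \<open>The bound on \<open>n\<close> enters here: no prescribed vertex exceeds
    \<open>r + h - 1 = k + 2 * h - 2 \<le> 2 * k - 2\<close>.\<close>
  have v_less: "v t < n" if "t < k" for t
    using that k assms(2) h by (auto simp: v_def r_def)
  have v_inj: "inj_on v {..<k}"
  proof (rule inj_onI)
    fix s t assume "s \<in> {..<k}" "t \<in> {..<k}" "v s = v t"
    \<comment> \<open>Even positions thus carry values below \<open>r\<close> and odd ones values
      from \<open>r\<close> on, so equal values force equal parity.\<close>
    moreover have "s div 2 < r" "t div 2 < r"
      using \<open>s \<in> _\<close> \<open>t \<in> _\<close> k h by (auto simp: r_def)
    ultimately show "s = t"
      by (auto simp: v_def split: if_splits elim!: evenE oddE)
  qed
  define vs where "vs = map v [0..<k]"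
  have len_vs: "length vs = k" and nth_vs: "\<And>t. t < k \<Longrightarrow> vs ! t = v t"
    by (simp_all add: vs_def)
  have "distinct vs"
    using v_inj by (simp add: vs_def distinct_map lessThan_atLeast0)
  moreover have "set vs \<subseteq> pverts (graph_power (path_graph n) p)"
    using v_less by (auto simp: vs_def pverts_power_path_graph)
  ultimately obtain c where c: "hamiltonian_cycle (graph_power (path_graph n) p) c"
      and hd_c: "fst (hd c) = hd vs" and sub: "subseq vs (map fst c)"
    using ham len_vs unfolding ordered_hamiltonian_def by blast
  define xs where "xs = map fst c"
  have xs: "distinct xs" "set xs = {..<n}" "3 \<le> length xs" "length xs = length c"
    using c by (auto simp: hamiltonian_cycle_iff pverts_power_path_graph xs_def)
  have step: "xs ! Suc i \<le> xs ! i + p \<and> xs ! i \<le> xs ! Suc i + p" if "Suc i < length xs" for i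
    using hamiltonian_cycle_arc[OF c, of i] that
    by (simp add: parcs_power_path_graph xs_def del: nth_map)
  have last_step: "xs ! (length xs - 1) \<le> xs ! 0 + p"
    using hamiltonian_cycle_last_arc[OF c]
    by (simp add: parcs_power_path_graph xs_def del: nth_map)
  obtain f where f_mono: "strict_mono_on {..<k} f"
      and f_less: "\<And>t. t < k \<Longrightarrow> f t < length xs" and nth_f: "\<And>t. t < k \<Longrightarrow> xs ! f t = v t"
    using subseq_indices[OF sub, folded xs_def] nth_vs unfolding len_vs by auto
  have xs_0: "xs ! 0 = v 0"
  proof -
    have "hd vs = v 0"
      using assms(1) nth_vs[of 0] len_vs by (cases vs) auto
    moreover have "fst (hd c) = xs ! 0"
      using xs(3,4) by (cases c) (auto simp: xs_def)
    ultimately show ?thesis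
      using hd_c by simp
  qed
  have f_0: "f 0 = 0"
  proof -
    have "xs ! f 0 = xs ! 0" "f 0 < length xs" "0 < length xs"
      using nth_f[of 0] f_less[of 0] xs_0 xs(3) assms(1) by auto
    then show ?thesis
      using xs(1) by (simp add: nth_eq_iff_index_eq)
  qed
  \<comment> \<open>The cycle returns to \<open>v 0\<close> after its last vertex, so the last arc ends at index \<open>length xs\<close>.\<close>
  define F where "F t = (if t < k then f t else length xs)" for t
  have F_mono: "F s < F t" if "s < t" "t \<le> k" for s t
    using that f_mono f_less by (auto simp: F_def strict_mono_on_def)
  have F_mono': "F s \<le> F t" if "s \<le> t" "t \<le> k" for s t
    using F_mono[of s t] that by (cases "s = t") auto
  \<comment> \<open>index of the inner vertex next to the left end of the \<open>t\<close>-th arc\<close>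
  define g where "g t = (if even t then Suc (F t) else F (Suc t) - 1)" for t
  \<comment> \<open>For even \<open>k\<close> these arcs include the closing one back to
    \<open>v 0\<close>. For odd \<open>k\<close> the closing arc joins two left vertices and is left
    out.\<close>
  have g: "F t < g t \<and> g t < F (Suc t) \<and> k - h \<le> xs ! g t \<and> xs ! g t < r" if "t < 2 * h" for t
  proof -
    have tk: "t < k" "Suc t \<le> k"
      using that k by auto
    have F_less: "F t < F (Suc t)"
      using F_mono[of t "Suc t"] tk by simp
    have F_le: "F (Suc t) \<le> length xs"
      using F_mono'[of "Suc t" k] tk by (simp add: F_def)
    have nth_F: "xs ! F t = v t"
      using tk nth_f by (simp add: F_def)
    \<comment> \<open>The left end of the \<open>t\<close>-th arc: its start for even
      \<open>t\<close>, its end for odd \<open>t\<close>, with \<open>v 0\<close> as the end of the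
      closing arc.\<close>
    define x where "x = (if even t then v t else v (if Suc t < k then Suc t else 0))"
    have x: "x < k - h"
      using that k h by (auto simp: x_def v_def elim!: oddE)
    have near: "xs ! g t \<le> x + p"
    proof (cases "even t")
      case True
      then have "Suc t < k"
        using that k by (auto elim!: evenE)
      then have "Suc (F t) < length xs"
        using F_less f_less[of "Suc t"] by (simp add: F_def)
      then show ?thesis
        using step[of "F t"] True nth_F by (simp add: g_def x_def)
    next
      case False
      show ?thesis
      proof (cases "Suc t < k")
        case True
        then have "Suc (F (Suc t) - 1) < length xs" "xs ! Suc (F (Suc t) - 1) = v (Suc t)"
          using F_less f_less[of "Suc t"] nth_f[of "Suc t"] by (auto simp: F_def)
        then show ?thesis
          using step[of "F (Suc t) - 1"] False True by (simp add: g_def x_def)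
      next
        case False
        then show ?thesis
          using last_step xs_0 \<open>odd t\<close> by (simp add: g_def x_def F_def)
      qed
    qed
    \<comment> \<open>Otherwise \<open>g t\<close> would be the index of the right end, whose
      distance from \<open>x\<close> is at least \<open>r - 1 > p\<close>, against
      \<open>near\<close>.\<close>
    have not_adjacent: "Suc (F t) \<noteq> F (Suc t)"
    proof
      assume adj: "Suc (F t) = F (Suc t)"
      show False
      proof (cases "even t")
        case True
        then have "Suc t < k"
          using that k by (auto elim!: evenE)
        then have "xs ! g t = v (Suc t)"
          using True adj nth_f[of "Suc t"] by (simp add: g_def F_def)
        then show False
          using near True p by (auto simp: x_def v_def)
      next
        case False
        then have "xs ! g t = v t"
          using adj[symmetric] nth_F by (simp add: g_def)
        then show False
          using near False p by (auto simp: x_def v_def split: if_splits elim!: oddE)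
      qed
    qed
    have between: "F t < g t" "g t < F (Suc t)"
      using F_less not_adjacent by (auto simp: g_def)
    \<comment> \<open>The index \<open>g t\<close> lies strictly between consecutive values of
      \<open>F\<close>, and \<open>xs\<close> has no repetitions.\<close>
    have "xs ! g t \<noteq> v s" if "s < k" for s
    proof
      assume "xs ! g t = v s"
      then have "xs ! g t = xs ! F s"
        using nth_f that by (simp add: F_def)
      moreover have "g t < length xs" "F s < length xs"
        using between F_le f_less that by (auto simp: F_def)
      ultimately have "g t = F s"
        using xs(1) by (simp add: nth_eq_iff_index_eq)
      moreover have "F s \<le> F t \<or> F (Suc t) \<le> F s"
        using F_mono'[of s t] F_mono'[of "Suc t" s] tk that by linarith
      ultimately show False
        using between by linarith
    qed
    then have "\<not> xs ! g t < k - h" "\<not> (r \<le> xs ! g t \<and> xs ! g t < r + h)"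
      using left right by metis+
    \<comment> \<open>Vertices beyond the right block are out of reach:
      \<open>x + p \<le> (k - h - 1) + (r - 2) < r + h\<close>, as
      \<open>k - h \<le> h + 1\<close>.\<close>
    moreover have "xs ! g t < r + h"
      using near x p k by auto
    ultimately show ?thesis
      using between by auto
  qed
  \<comment> \<open>Different arcs use disjoint index ranges:
    \<open>g s < F (Suc s) \<le> F t < g t\<close> for \<open>s < t\<close>.\<close>
  have "inj_on (\<lambda>t. xs ! g t) {..<2 * h}"
  proof (rule linorder_inj_onI')
    fix s t assume st: "s \<in> {..<2 * h}" "t \<in> {..<2 * h}" "s < t"
    have bounds: "Suc t \<le> k"
      using st k by auto
    then have "F (Suc t) \<le> length xs" "F (Suc s) \<le> F t"
      using F_mono'[of "Suc t" k] F_mono'[of "Suc s" t] st by (auto simp: F_def)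
    then have "g s < g t" "g t < length xs"
      using g[of s] g[of t] st by auto
    then show "xs ! g s \<noteq> xs ! g t"
      using xs(1) by (simp add: nth_eq_iff_index_eq)
  qed
  moreover have "(\<lambda>t. xs ! g t) ` {..<2 * h} \<subseteq> {k - h..<r}"
    using g by auto
  ultimately have "card {..<2 * h} \<le> card {k - h..<r}"
    by (intro card_inj_on_le) auto
  then show False
    using h by (simp add: r_def)
qed

theorem theorem3p1:
  fixes k n :: nat
  assumes "k \<ge> 3" and "n \<ge> 2 * k - 1"
  shows "int (ordered_power k (path_graph n)) \<ge> \<lfloor>3 * real k / 2\<rfloor> - 2"
proof -
  define P where "P p \<longleftrightarrow> 1 \<le> p \<and> ordered_hamiltonian k (graph_power (path_graph n) p)" for p
  \<comment> \<open>\<open>LeastI\<close> needs a witness: any two vertices differ by less than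
    \<open>n\<close>, so the \<open>n\<close>-th power is complete, and \<open>n \<ge> 5\<close>
    leaves enough vertices for a cycle.\<close>
  have "P n"
    unfolding P_def
    using assms by (auto intro!: ordered_hamiltonian_complete
        simp: pverts_power_path_graph parcs_power_path_graph)
  then have "P (ordered_power k (path_graph n))"
    unfolding ordered_power_def P_def by (rule LeastI)
  then have "3 * k div 2 \<le> ordered_power k (path_graph n) + 2"
    using ordered_hamiltonian_path_power_lower_bound[OF assms] by (simp add: P_def)
  moreover have "\<lfloor>3 * real k / 2\<rfloor> = int (3 * k div 2)"
    using floor_divide_of_nat_eq[of "3 * k" 2, where ?'a = real] by simp
  ultimately show ?thesis
    by linarith
qed

end
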